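(* Let $A=(a_{ij})$ be a nonnegative $n\times m$ real matrix without zero columns, with rows $a_1,\dots,a_n$. Let $\{y_1,\dots,y_r\}$ be a basic set of the rows of $A$, let $\beta$ be the basic function of $y_1,\dots,y_r$, let $K$ be the convex polytope generated by the range $R(\beta)$ of $\beta$, and let $d$ be the number of vertices of $K$. Then there exist nonnegative real matrices $F$ of size $n\times d$ and $V$ of size $d\times m$ such that $$A=FV,$$ and they are determined as follows. There exist a minimal lattice-subspace $Z$ of $\mathbb{R}^m$ containing $y_1,\dots,y_r$, a positive basis $\{b_1,\dots,b_d\}$ of $Z$ (with exactly $d$ elements) and a set of nodes $\{i_1,\dots,i_d\}$ of this basis; and for any such $Z$, $\{b_1,\dots,b_d\}$ and $\{i_1,\dots,i_d\}$, if $F$ is the $n\times d$ matrix whose $k$-th column ($k=1,\dots,d$) is the $i_k$-th column of $A$ multiplied by $\frac{1}{b_k(i_k)}$, and $V$ is the $d\times m$ matrix with rows $b_1,\dots,b_d$, then $F$ and $V$ are nonnegative and $A=FV$. Moreover, for this factorization: (i) If $r=2$, then $d=2$ and $A=FV$ is a (exact) rank factorization of $A$. (ii) If the function $\beta$ takes exactly $r$ different values, then $A=FV$ is a rank factorization of $A$. (iii) If $K$ has $r$ vertices, then $r=d$ and $A=FV$ is a rank factorization of $A$. (iv) If $d=m$, then $A=FV$ is a trivial factorization of $A$, i.e. the set of rows of $V$ is a positive basis of $\mathbb{R}^m$.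
   Context: For $x\in\mathbb{R}^m$, $x(i)$ denotes the $i$-th coordinate of $x$. $\mathbb{R}^m$ is ordered coordinatewise; $\mathbb{R}^m_+=\{x: x(i)\ge 0\ \forall i\}$. A matrix is nonnegative if all its entries are $\ge 0$. A linear subspace $Y\subseteq\mathbb{R}^m$ is ordered by the induced ordering, with positive cone $Y_+=Y\cap\mathbb{R}^m_+$. Lattice-subspace: a linear subspace $Y$ of $\mathbb{R}^m$ such that for all $x,y\in Y$ the set $\{x,y\}$ has a supremum and an infimum in the ordered space $Y$ (a least element of the set of upper bounds belonging to $Y$, and a greatest element of the set of lower bounds belonging to $Y$); these need not be the coordinatewise ones. Positive basis of $Y$: a linear basis $\{b_1,\dots,b_\nu\}$ of $Y$ such that $Y_+=\{\sum_{i=1}^\nu\lambda_i b_i : \lambda_i\ge 0 \text{ for each } i\}$. Set of nodes of a positive basis $\{b_1,\dots,b_\nu\}$: indices $\{i_1,\dots,i_\nu\}\subseteq\{1,\dots,m\}$ such that for every $k$ one has $b_k(i_k)>0$ and $b_j(i_k)=0$ for all $j\ne k$. Minimal lattice-subspace containing a set $S\subseteq\mathbb{R}^m_+$: a lattice-subspace $Y$ of $\mathbb{R}^m$ with $S\subseteq Y$ such that no proper linear subspace of $Y$ is a lattice-subspace of $\mathbb{R}^m$ containing $S$. Basic set of the rows of $A$: a maximal set $\{y_1,\dots,y_r\}$ of linearly independent rows of $A$ (so $r=\operatorname{rank}(A)$). Basic function of $y_1,\dots,y_r$: with $y=y_1+\dots+y_r$, the function $\beta:\{1,\dots,m\}\to\mathbb{R}^r_+$,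 $\beta(i)=\left(\frac{y_1(i)}{y(i)},\dots,\frac{y_r(i)}{y(i)}\right)$. (Since $A$ has no zero columns, $y(i)>0$ for all $i$.) Its range is $R(\beta)=\{\beta(i): i=1,\dots,m\}$, as a set of distinct vectors; $K$ is the convex hull of $R(\beta)$ in $\mathbb{R}^r$ and its vertices are its extreme points. Rank factorization (nonnegative rank factorization) of $A$: a factorization $A=FV$ with $F$, $V$ nonnegative of sizes $n\times p$, $p\times m$, whose intermediate dimension $p$ equals $\operatorname{rank}(A)$. *)

theory Defs
  imports "HOL-Analysis.Analysis" "HOL-Library.Lub_Glb"
begin

text \<open>
  Vectors of \<open>\<real>\<^sup>m\<close> are of type \<^typ>\<open>real ^ 'm\<close>, whose order is the coordinatewise one; an
  \<open>n \<times> m\<close> matrix is of type \<^typ>\<open>real ^ 'm ^ 'n\<close> (a vector of rows). Families \<open>y\<^sub>1, \<dots>, y\<^sub>r\<close> and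
  \<open>b\<^sub>1, \<dots>, b\<^sub>d\<close> are functions on finite index types with \<open>r\<close> and \<open>d\<close> elements.
\<close>

definition nonneg_matrix :: "real ^ 'm ^ 'n \<Rightarrow> bool" where
  "nonneg_matrix A \<longleftrightarrow> (\<forall>i j. 0 \<le> A $ i $ j)"

text \<open>\<^term>\<open>isLub Y S s\<close> says that \<open>s\<close> is the least among the upper bounds of \<open>S\<close> that lie in \<open>Y\<close>, so
  suprema and infima are those of the ordered space \<open>Y\<close>, which need not be coordinatewise.\<close>

definition lattice_subspace :: "(real ^ 'm) set \<Rightarrow> bool" where
  "lattice_subspace Y \<longleftrightarrow>
     subspace Y \<and> (\<forall>x\<in>Y. \<forall>y\<in>Y. (\<exists>s. isLub Y {x, y} s) \<and> (\<exists>t. isGlb Y {x, y} t))"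

definition minimal_lattice_subspace :: "(real ^ 'm) set \<Rightarrow> (real ^ 'm) set \<Rightarrow> bool" where
  "minimal_lattice_subspace S Z \<longleftrightarrow>
     lattice_subspace Z \<and> S \<subseteq> Z \<and> \<not> (\<exists>W. W \<subset> Z \<and> lattice_subspace W \<and> S \<subseteq> W)"

definition positive_basis :: "(real ^ 'm) set \<Rightarrow> ('d::finite \<Rightarrow> real ^ 'm) \<Rightarrow> bool" where
  "positive_basis Y b \<longleftrightarrow>
     inj b \<and> independent (range b) \<and> span (range b) = Y \<and>
     {x \<in> Y. 0 \<le> x} = {\<Sum>k\<in>UNIV. c k *\<^sub>R b k | c. \<forall>k. 0 \<le> c k}"

definition nodes :: "('d \<Rightarrow> real ^ 'm) \<Rightarrow> ('d \<Rightarrow> 'm) \<Rightarrow> bool" where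
  "nodes b \<iota> \<longleftrightarrow> (\<forall>k. 0 < b k $ \<iota> k \<and> (\<forall>j. j \<noteq> k \<longrightarrow> b j $ \<iota> k = 0))"

definition basic_set :: "real ^ 'm ^ 'n \<Rightarrow> ('r \<Rightarrow> real ^ 'm) \<Rightarrow> bool" where
  "basic_set A y \<longleftrightarrow>
     inj y \<and> range y \<subseteq> rows A \<and> independent (range y) \<and>
     (\<forall>B. range y \<subseteq> B \<and> B \<subseteq> rows A \<and> independent B \<longrightarrow> B = range y)"

definition basic_function :: "('r::finite \<Rightarrow> real ^ 'm) \<Rightarrow> 'm \<Rightarrow> real ^ 'r" where
  "basic_function y i = (\<chi> k. y k $ i / (\<Sum>l\<in>UNIV. y l) $ i)"

definition basic_polytope :: "('r::finite \<Rightarrow> real ^ 'm) \<Rightarrow> (real ^ 'r) set" where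
  "basic_polytope y = convex hull (range (basic_function y))"

definition vertices :: "'a::real_vector set \<Rightarrow> 'a set" where
  "vertices K = {v. v extreme_point_of K}"

definition rank_factorization ::
    "real ^ 'm ^ 'n \<Rightarrow> real ^ 'p ^ 'n \<Rightarrow> real ^ 'm ^ 'p \<Rightarrow> bool" where
  "rank_factorization A F V \<longleftrightarrow>
     nonneg_matrix F \<and> nonneg_matrix V \<and> A = F ** V \<and> CARD('p) = rank A"

end

theory Submission
  imports Defs
begin

text \<open>
  A lattice-subspace \<open>W\<close> has a positive basis with nodes: since infima exist in \<open>W\<close>, the extreme
  points of the compact base of its positive cone are pairwise disjoint in the ordered space \<open>W\<close>,
  hence linearly independent; an extreme point \<open>e\<close> without a node would lie below a multiple of the
  sum of the others, from which it is disjoint. If \<open>W\<close> contains the \<open>y\<^sub>l\<close>, expanding them in this basis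
  writes every \<open>\<beta>(i)\<close> as a convex combination of the values of \<open>\<beta>\<close> at the nodes, so \<open>K\<close> has at
  most \<open>dim W\<close> vertices. Conversely, expanding each \<open>\<beta>(i)\<close> as a convex combination
  \<open>\<Sum>\<^sub>k \<xi>\<^sub>k(i) P\<^sub>k\<close> of the vertices of \<open>K\<close>, the vectors \<open>b\<^sub>k = y \<xi>\<^sub>k\<close> have nodes at the indices where
  \<open>\<beta>\<close> takes the values \<open>P\<^sub>k\<close>, and they span a lattice-subspace of dimension \<open>d\<close> containing the
  \<open>y\<^sub>l\<close>; by the dimension bound it is minimal. A vector in the span of a basis with nodes is
  determined by its values at the nodes, which gives \<open>A = F V\<close>.
\<close>

section \<open>Disjointness in an ordered subspace\<close>

text \<open>For nonnegative \<open>x\<close>, \<open>z\<close> in a subspace \<open>W\<close> this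
  says that 0 is their infimum in \<open>W\<close>, phrased so that no infimum has to be known to
  exist.\<close>

definition disjoint_in :: "'a::ordered_real_vector set \<Rightarrow> 'a \<Rightarrow> 'a \<Rightarrow> bool" where
  "disjoint_in W x z \<longleftrightarrow> (\<forall>w\<in>W. w \<le> x \<longrightarrow> w \<le> z \<longrightarrow> w \<le> 0)"

lemma disjoint_in_commute: "disjoint_in W x z \<longleftrightarrow> disjoint_in W z x"
  by (auto simp: disjoint_in_def)

text \<open>Subtract \<open>x\<close> from a common minorant \<open>w\<close> of
  \<open>x + x'\<close> and \<open>z\<close>. The difference lies below \<open>x'\<close> and, as
  \<open>0 \<le> x\<close>, below \<open>z\<close>, so \<open>w \<le> x\<close>; the disjointness of
  \<open>x\<close> and \<open>z\<close> then finishes.\<close>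

lemma disjoint_in_add:
  assumes "subspace W" "x \<in> W" "0 \<le> x" "disjoint_in W x z" "disjoint_in W x' z"
  shows "disjoint_in W (x + x') z"
  unfolding disjoint_in_def
proof (intro ballI impI)
  fix w assume w: "w \<in> W" "w \<le> x + x'" "w \<le> z"
  have "w - x \<in> W" "w - x \<le> x'" "w - x \<le> z"
    using assms w by (auto simp: subspace_diff diff_le_eq add.commute intro: order_trans add_increasing)
  then have "w \<le> x"
    using assms(5) by (auto simp: disjoint_in_def)
  then show "w \<le> 0"
    using assms(4) w by (auto simp: disjoint_in_def)
qed

lemma disjoint_in_scaleR:
  assumes "subspace W" "0 \<le> x" "0 \<le> z" "disjoint_in W x z" "0 \<le> c"
  shows "disjoint_in W (c *\<^sub>R x) z"
  unfolding disjoint_in_def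
proof (intro ballI impI)
  fix w assume w: "w \<in> W" "w \<le> c *\<^sub>R x" "w \<le> z"
  \<comment> \<open>Shrinking by \<open>d\<close> brings \<open>w\<close> below \<open>x\<close>
    because \<open>c \<le> d\<close>, and keeps it below \<open>z\<close> because
    \<open>1 \<le> d\<close>.\<close>
  define d where "d = max 1 c"
  have d: "1 \<le> d" "0 < d" "c \<le> d"
    by (auto simp: d_def)
  have "(1/d) *\<^sub>R w \<le> (1/d) *\<^sub>R (d *\<^sub>R x)"
    using w d assms by (intro scaleR_left_mono) (auto intro: order_trans scaleR_right_mono)
  then have "(1/d) *\<^sub>R w \<le> x"
    using d by simp
  moreover have "(1/d) *\<^sub>R w \<le> z"
  proof -
    have "(1/d) *\<^sub>R w \<le> (1/d) *\<^sub>R z"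
      using w d by (intro scaleR_left_mono) auto
    also have "\<dots> \<le> 1 *\<^sub>R z"
      using d assms by (intro scaleR_right_mono) auto
    finally show ?thesis by simp
  qed
  ultimately have "(1/d) *\<^sub>R w \<le> 0"
    using assms w by (auto simp: disjoint_in_def subspace_scale)
  then have "d *\<^sub>R ((1/d) *\<^sub>R w) \<le> d *\<^sub>R 0"
    using d by (intro scaleR_left_mono) auto
  then show "w \<le> 0"
    using d by simp
qed

lemma disjoint_in_sum:
  assumes "subspace W" "finite S" "0 \<le> z"
    and "\<And>v. v \<in> S \<Longrightarrow> v \<in> W \<and> 0 \<le> v \<and> disjoint_in W v z \<and> 0 \<le> c v"
  shows "disjoint_in W (\<Sum>v\<in>S. c v *\<^sub>R v) z"
  using assms(2,4)
proof (induction S rule: finite_induct)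
  case empty
  then show ?case by (simp add: disjoint_in_def)
next
  case (insert v S)
  then show ?case
    using assms(1,3)
    by (auto intro!: disjoint_in_add disjoint_in_scaleR scaleR_nonneg_nonneg simp: subspace_scale)
qed

section \<open>The base of the positive cone and its extreme points\<close>

text \<open>On nonnegative vectors the coordinate sum is the l1 norm, so each nonzero element of the
  positive cone of a subspace has exactly one positive multiple in this slice.\<close>

definition cone_base :: "(real ^ 'm) set \<Rightarrow> (real ^ 'm) set" where
  "cone_base W = {x \<in> W. 0 \<le> x \<and> (\<Sum>i\<in>UNIV. x $ i) = 1}"

lemma convex_cone_base:
  assumes "subspace W"
  shows "convex (cone_base W)"
  unfolding convex_def cone_base_def
  using assms
  by (auto simp: subspace_add subspace_scale sum.distrib sum_distrib_left[symmetric] less_eq_vec_def)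

lemma compact_cone_base:
  assumes "subspace W"
  shows "compact (cone_base W)"
proof -
  have "cone_base W = W \<inter> {x. \<forall>i. x $ i \<in> {0..}} \<inter> {x. (\<Sum>i\<in>UNIV. x $ i) = 1}"
    by (auto simp: cone_base_def less_eq_vec_def)
  moreover have "closed {x::real^'m. \<forall>i. x $ i \<in> {0..}}"
    by (rule closed_vector_box) auto
  moreover have "closed {x::real^'m. (\<Sum>i\<in>UNIV. x $ i) = 1}"
    by (intro closed_Collect_eq continuous_intros)
  ultimately have "closed (cone_base W)"
    using closed_subspace[OF assms] by auto
  moreover have "bounded (cone_base W)"
    unfolding bounded_iff
  proof (intro exI[of _ 1] ballI)
    fix x assume x: "x \<in> cone_base W"
    have "norm x \<le> (\<Sum>i\<in>UNIV. \<bar>x $ i\<bar>)"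
      by (rule norm_le_l1_cart)
    also have "\<dots> = 1"
      using x by (auto simp: cone_base_def less_eq_vec_def)
    finally show "norm x \<le> 1" .
  qed
  ultimately show ?thesis
    by (simp add: compact_eq_bounded_closed)
qed

lemma sum_coords_eq_0:
  fixes x :: "real ^ 'm"
  assumes "0 \<le> x" "(\<Sum>i\<in>UNIV. x $ i) = 0"
  shows "x = 0"
  using assms by (auto simp: vec_eq_iff less_eq_vec_def sum_nonneg_eq_0_iff)

lemma cone_base_normalize:
  assumes "subspace W" "x \<in> W" "0 \<le> x" "x \<noteq> 0"
  shows "(1 / (\<Sum>i\<in>UNIV. x $ i)) *\<^sub>R x \<in> cone_base W" "0 < (\<Sum>i\<in>UNIV. x $ i)"
proof -
  have "(\<Sum>i\<in>UNIV. x $ i) \<noteq> 0"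
    using sum_coords_eq_0 assms by blast
  moreover have "0 \<le> (\<Sum>i\<in>UNIV. x $ i)"
    using assms by (auto simp: less_eq_vec_def intro: sum_nonneg)
  ultimately show pos: "0 < (\<Sum>i\<in>UNIV. x $ i)"
    by linarith
  then show "(1 / (\<Sum>i\<in>UNIV. x $ i)) *\<^sub>R x \<in> cone_base W"
    using assms by (auto simp: cone_base_def subspace_scale less_eq_vec_def sum_divide_distrib[symmetric])
qed

text \<open>Extreme points of the base generate extremal rays: normalizing both parts of
  \<open>e = t + (e - t)\<close> exhibits \<open>e\<close> as a convex combination of two base
  points, which must then coincide. A part equal to 0 cannot be normalized and is treated
  separately.\<close>

lemma minorant_of_extreme_point:
  assumes W: "subspace W" and e: "e extreme_point_of cone_base W"
    and t: "t \<in> W" "0 \<le> t" "t \<le> e"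
  shows "t = (\<Sum>i\<in>UNIV. t $ i) *\<^sub>R e"
proof -
  define s where "s = (\<Sum>i\<in>UNIV. t $ i)"
  have eB: "e \<in> W" "0 \<le> e" "(\<Sum>i\<in>UNIV. e $ i) = 1"
    using e by (auto simp: extreme_point_of_def cone_base_def)
  have se: "(\<Sum>i\<in>UNIV. (e - t) $ i) = 1 - s"
    using eB by (simp add: s_def sum_subtractf)
  consider "t = 0" | "e - t = 0" | "t \<noteq> 0" "e - t \<noteq> 0" by blast
  then show ?thesis
  proof cases
    case 1
    then show ?thesis by simp
  next
    case 2
    then show ?thesis using eB by simp
  next
    case 3
    have a: "(1/s) *\<^sub>R t \<in> cone_base W" "0 < s"
      using cone_base_normalize[OF W t(1,2) 3(1)] by (auto simp: s_def)
    have b: "(1/(1-s)) *\<^sub>R (e - t) \<in> cone_base W" "0 < 1 - s"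
      using cone_base_normalize[OF W _ _ 3(2)] t eB W unfolding se by (auto simp: subspace_diff)
    have "e = (1 - s) *\<^sub>R ((1/(1-s)) *\<^sub>R (e - t)) + s *\<^sub>R ((1/s) *\<^sub>R t)"
      using a b by simp
    moreover have "e \<notin> open_segment ((1/(1-s)) *\<^sub>R (e - t)) ((1/s) *\<^sub>R t)"
      using e a b by (auto simp: extreme_point_of_def)
    ultimately have eq: "(1/(1-s)) *\<^sub>R (e - t) = (1/s) *\<^sub>R t"
      using a b unfolding in_segment by (metis less_iff_diff_less_0 diff_gt_0_iff_gt)
    with \<open>e = _\<close> have "e = (1/s) *\<^sub>R t"
      using scaleR_left_distrib[of "1 - s" s "(1/s) *\<^sub>R t"] by simp
    then show ?thesis
      using a by (simp add: s_def[symmetric])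
  qed
qed

text \<open>Here the existence of infima enters. The infimum of \<open>e\<close> and
  \<open>f\<close> in \<open>W\<close> is a multiple of each of them, with its own coordinate sum as
  the factor in both cases; as \<open>e \<noteq> f\<close>, that factor is 0.\<close>

lemma disjoint_in_extreme_points:
  assumes L: "lattice_subspace W" and e: "e extreme_point_of cone_base W"
    and f: "f extreme_point_of cone_base W" and "e \<noteq> f"
  shows "disjoint_in W e f"
proof -
  have W: "subspace W"
    using L by (simp add: lattice_subspace_def)
  have eB: "e \<in> W" "0 \<le> e" "(\<Sum>i\<in>UNIV. e $ i) = 1" and fB: "f \<in> W" "0 \<le> f" "(\<Sum>i\<in>UNIV. f $ i) = 1"
    using e f by (auto simp: extreme_point_of_def cone_base_def)
  obtain t where t: "isGlb W {e, f} t"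
    using L eB fB unfolding lattice_subspace_def by blast
  have tW: "t \<in> W" and "t \<le> e" "t \<le> f"
    using isGlbD1a[OF t] isGlbD2[OF t] by auto
  have least: "w \<le> t" if "w \<in> W" "w \<le> e" "w \<le> f" for w
    using isGlb_le_isLb[OF t] that by (auto simp: isLb_def setge_def)
  have "0 \<le> t"
    using least eB fB W by (auto simp: subspace_0)
  define s where "s = (\<Sum>i\<in>UNIV. t $ i)"
  have "t = s *\<^sub>R e" "t = s *\<^sub>R f"
    using minorant_of_extreme_point[OF W e tW \<open>0 \<le> t\<close> \<open>t \<le> e\<close>]
      minorant_of_extreme_point[OF W f tW \<open>0 \<le> t\<close> \<open>t \<le> f\<close>] by (auto simp: s_def)
  then have "t = 0"
    using \<open>e \<noteq> f\<close> by auto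
  then show ?thesis
    using least by (auto simp: disjoint_in_def)
qed

text \<open>Sort a linear relation by the signs of its coefficients into \<open>p = n\<close>, both
  nonnegative. The two sides use different elements of \<open>E\<close>, so \<open>p\<close> is
  disjoint from itself and vanishes, and with it every term.\<close>

lemma independent_pairwise_disjoint:
  fixes E :: "'a::ordered_real_vector set"
  assumes W: "subspace W" and E: "\<And>e. e \<in> E \<Longrightarrow> e \<in> W \<and> 0 \<le> e \<and> e \<noteq> 0"
    and dis: "\<And>e f. e \<in> E \<Longrightarrow> f \<in> E \<Longrightarrow> e \<noteq> f \<Longrightarrow> disjoint_in W e f"
  shows "independent E"
  unfolding independent_explicit_finite_subsets
proof (intro allI impI)
  fix S u
  assume S: "S \<subseteq> E" "finite S" and sum0: "(\<Sum>v\<in>S. u v *\<^sub>R v) = 0"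
  define P where "P = {v\<in>S. 0 \<le> u v}"
  define N where "N = {v\<in>S. u v < 0}"
  define p where "p = (\<Sum>v\<in>P. u v *\<^sub>R v)"
  define n where "n = (\<Sum>v\<in>N. (- u v) *\<^sub>R v)"
  have PN: "P \<union> N = S" "P \<inter> N = {}" "finite P" "finite N"
    using S by (auto simp: P_def N_def)
  have "p - n = 0"
    using sum0 sum.union_disjoint[OF PN(3,4,2), of "\<lambda>v. u v *\<^sub>R v"] PN
    by (simp add: p_def n_def sum_negf)
  then have "p = n" by simp
  have termP: "0 \<le> u v *\<^sub>R v" if "v \<in> P" for v
    using that S E by (auto simp: P_def intro!: scaleR_nonneg_nonneg)
  have termN: "0 \<le> (- u v) *\<^sub>R v" if "v \<in> N" for v
    using that S E by (intro scaleR_nonneg_nonneg) (auto simp: N_def)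
  have p0: "0 \<le> p" and n0: "0 \<le> n"
    unfolding p_def n_def by (rule sum_nonneg; use termP termN in blast)+
  have pW: "p \<in> W"
    unfolding p_def using W S E by (intro subspace_sum subspace_scale) (auto simp: P_def)
  have "disjoint_in W p v" if "v \<in> N" for v
    unfolding p_def using that S E W
    by (intro disjoint_in_sum) (auto simp: P_def N_def intro!: dis)
  then have "disjoint_in W n p"
    unfolding n_def using p0 S E W
    by (intro disjoint_in_sum) (auto simp: N_def disjoint_in_commute)
  then have "p \<le> 0"
    using \<open>p = n\<close> pW by (auto simp: disjoint_in_def)
  then have z: "p = 0" "n = 0"
    using p0 \<open>p = n\<close> by auto
  have "u v *\<^sub>R v = 0" if "v \<in> S" for v
  proof (cases "v \<in> P")
    case True
    then show ?thesis
      using z(1) termP PN(3) unfolding p_def by (metis (no_types, lifting) sum_nonneg_eq_0_iff)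
  next
    case False
    then have "v \<in> N" using that PN by auto
    then have "(- u v) *\<^sub>R v = 0"
      using z(2) termN PN(4) unfolding n_def by (metis (no_types, lifting) sum_nonneg_eq_0_iff)
    then show ?thesis by simp
  qed
  then show "\<forall>v\<in>S. u v = 0"
    using E S by auto
qed

section \<open>Interpolation at nodes and the lower bound on the dimension\<close>

text \<open>\<open>E\<close> consists of the extreme points of the base and \<open>\<nu> e\<close>
  is a node of \<open>e\<close>. The formula is the expansion of \<open>x\<close> in
  \<open>E\<close>, read at coordinate \<open>i\<close>, with coefficients recovered from the
  nodes.\<close>

lemma lattice_subspace_interpolation:
  fixes W :: "(real ^ 'm) set"
  assumes L: "lattice_subspace W"
  obtains E and \<nu> :: "real ^ 'm \<Rightarrow> 'm" where
    "finite E" "independent E" "E \<subseteq> W" "\<And>e. e \<in> E \<Longrightarrow> 0 \<le> e \<and> 0 < e $ \<nu> e"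
    "\<And>x i. x \<in> W \<Longrightarrow> 0 \<le> x \<Longrightarrow> x $ i = (\<Sum>e\<in>E. e $ i / e $ \<nu> e * x $ \<nu> e)"
proof -
  have W: "subspace W"
    using L by (simp add: lattice_subspace_def)
  define E where "E = {e. e extreme_point_of cone_base W}"
  have E: "e \<in> W" "0 \<le> e" "e \<noteq> 0" if "e \<in> E" for e
    using that by (auto simp: E_def extreme_point_of_def cone_base_def)
  have dis: "disjoint_in W e f" if "e \<in> E" "f \<in> E" "e \<noteq> f" for e f
    using that L disjoint_in_extreme_points by (auto simp: E_def)
  have ind: "independent E"
    using W E dis by (intro independent_pairwise_disjoint[of W]) auto
  then have fin: "finite E"
    by (rule independent_imp_finite)
  have "\<exists>i. 0 < e $ i \<and> (\<forall>f\<in>E - {e}. f $ i = 0)" if e: "e \<in> E" for e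
  proof (rule ccontr)
    assume no: "\<nexists>i. 0 < e $ i \<and> (\<forall>f\<in>E - {e}. f $ i = 0)"
    define g where "g = (\<Sum>f\<in>E - {e}. f)"
    \<comment> \<open>Without a node, \<open>e\<close> vanishes wherever \<open>g\<close> does.
      Elsewhere \<open>N\<close> dominates each ratio, being a sum of nonnegative terms; the terms
      with \<open>g $ i = 0\<close> are 0 by the convention for division.\<close>
    define N where "N = (\<Sum>i\<in>UNIV. e $ i / g $ i)"
    have f0: "0 \<le> f $ i" if "f \<in> E" for f i
      using E that by (auto simp: less_eq_vec_def)
    have g0: "0 \<le> g $ i" for i
      unfolding g_def using f0 by (auto intro: sum_nonneg)
    have "e $ i \<le> N * g $ i" for i
    proof (cases "g $ i = 0")
      case True
      then have "\<forall>f\<in>E - {e}. f $ i = 0"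
        using f0 fin sum_nonneg_eq_0_iff[of "E - {e}" "\<lambda>f. f $ i"] by (simp add: g_def)
      then show ?thesis
        using no True by (auto simp: not_less)
    next
      case False
      have "e $ i / g $ i \<le> N"
        unfolding N_def using f0[OF e] g0 by (intro member_le_sum) auto
      then show ?thesis
        using False g0[of i] by (simp add: divide_simps split: if_splits)
    qed
    then have le: "e \<le> (\<Sum>f\<in>E - {e}. N *\<^sub>R f)"
      by (simp add: g_def less_eq_vec_def sum_distrib_left)
    have "0 \<le> N"
      unfolding N_def using f0[OF e] g0 by (auto intro: sum_nonneg)
    \<comment> \<open>The multiple of \<open>g\<close> that dominates \<open>e\<close> is also
      disjoint from \<open>e\<close>, so \<open>e\<close> is a common minorant of the two.\<close>
    then have "disjoint_in W (\<Sum>f\<in>E - {e}. N *\<^sub>R f) e"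
      using W fin E e by (intro disjoint_in_sum) (auto intro!: dis)
    then have "e \<le> 0"
      using le E[OF e] by (auto simp: disjoint_in_def)
    then show False
      using E[OF e] by auto
  qed
  then obtain \<nu> where \<nu>: "\<And>e. e \<in> E \<Longrightarrow> 0 < e $ \<nu> e"
    "\<And>e f. e \<in> E \<Longrightarrow> f \<in> E \<Longrightarrow> f \<noteq> e \<Longrightarrow> f $ \<nu> e = 0"
    by (metis DiffI singletonD)
  have "x $ i = (\<Sum>e\<in>E. e $ i / e $ \<nu> e * x $ \<nu> e)" if x: "x \<in> W" "0 \<le> x" for x i
  proof (cases "x = 0")
    case False
    define s where "s = (\<Sum>i\<in>UNIV. x $ i)"
    have s: "(1/s) *\<^sub>R x \<in> cone_base W" "0 < s"
      using cone_base_normalize[OF W x False] by (auto simp: s_def)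
    have "cone_base W = convex hull E"
      unfolding E_def using W by (intro Krein_Milman_Minkowski compact_cone_base convex_cone_base)
    then obtain c where "(1/s) *\<^sub>R x = (\<Sum>e\<in>E. c e *\<^sub>R e)"
      using s(1) fin by (auto simp: convex_hull_finite) metis
    then have "s *\<^sub>R (1/s) *\<^sub>R x = (\<Sum>e\<in>E. (s * c e) *\<^sub>R e)"
      by (simp add: scaleR_sum_right)
    then have x_eq: "x = (\<Sum>e\<in>E. (s * c e) *\<^sub>R e)"
      using s(2) by simp
    \<comment> \<open>At the node of \<open>e\<close> all other extreme points vanish, so only one
      term of the expansion survives.\<close>
    have "x $ \<nu> e = s * c e * e $ \<nu> e" if e: "e \<in> E" for e
    proof -
      have "x $ \<nu> e = (\<Sum>f\<in>E. s * c f * f $ \<nu> e)"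
        by (subst x_eq) simp
      also have "\<dots> = (\<Sum>f\<in>E. if f = e then s * c e * e $ \<nu> e else 0)"
        using \<nu>(2)[OF e] by (intro sum.cong) auto
      finally show ?thesis
        using e fin by simp
    qed
    then have "(\<Sum>e\<in>E. e $ i / e $ \<nu> e * x $ \<nu> e) = (\<Sum>e\<in>E. s * c e * e $ i)"
      using \<nu>(1) by (intro sum.cong) (auto simp: less_imp_neq[THEN not_sym])
    also have "\<dots> = x $ i"
      by (subst x_eq) simp
    finally show ?thesis by simp
  qed simp
  then show thesis
    using that[of E \<nu>] fin ind E \<nu>(1) by blast
qed

text \<open>The values of \<beta> at the nodes of \<open>E\<close> already generate the polytope, so
  its extreme points are among them, and the independent set \<open>E\<close> has at most
  \<open>dim W\<close> elements.\<close>

lemma card_vertices_le_dim: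
  fixes y :: "'r::finite \<Rightarrow> real ^ 'm"
  assumes L: "lattice_subspace W" and yW: "range y \<subseteq> W"
    and y0: "\<And>l. 0 \<le> y l" and pos: "\<And>i. 0 < (\<Sum>l\<in>UNIV. y l) $ i"
  shows "card (vertices (basic_polytope y)) \<le> dim W"
proof -
  obtain E and \<nu> :: "real ^ 'm \<Rightarrow> 'm" where E: "finite E" "independent E" "E \<subseteq> W"
    and \<nu>: "\<And>e. e \<in> E \<Longrightarrow> 0 \<le> e \<and> 0 < e $ \<nu> e"
    and interp: "\<And>x i. x \<in> W \<Longrightarrow> 0 \<le> x \<Longrightarrow> x $ i = (\<Sum>e\<in>E. e $ i / e $ \<nu> e * x $ \<nu> e)"
    using lattice_subspace_interpolation[OF L] by blast
  define s where "s = (\<Sum>l\<in>UNIV. y l)"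
  let ?\<beta> = "basic_function y"
  have W: "subspace W"
    using L by (simp add: lattice_subspace_def)
  have sW: "s \<in> W" "0 \<le> s"
    unfolding s_def using W yW y0 by (auto intro: subspace_sum sum_nonneg)
  have spos: "0 < s $ i" for i
    using pos by (simp add: s_def)
  have "?\<beta> i \<in> convex hull ((\<lambda>e. ?\<beta> (\<nu> e)) ` E)" for i
  proof -
    \<comment> \<open>The interpolation coefficient of \<open>e\<close> at \<open>i\<close>,
      rescaled because \<beta> divides by \<open>s\<close> at each index. Interpolating
      \<open>s\<close> itself shows that these weights sum to 1.\<close>
    define w where "w e = e $ i / e $ \<nu> e * s $ \<nu> e / s $ i" for e
    have "(\<Sum>e\<in>E. w e) = (\<Sum>e\<in>E. e $ i / e $ \<nu> e * s $ \<nu> e) / s $ i"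
      by (simp only: w_def sum_divide_distrib)
    also have "\<dots> = 1"
      using interp[OF sW, of i] spos[of i] by simp
    finally have "(\<Sum>e\<in>E. w e) = 1" .
    moreover have "0 \<le> w e" if "e \<in> E" for e
      using \<nu>[OF that] spos[of i] spos[of "\<nu> e"]
      by (auto simp: w_def less_eq_vec_def intro!: divide_nonneg_pos mult_nonneg_nonneg)
    moreover have "?\<beta> i = (\<Sum>e\<in>E. w e *\<^sub>R ?\<beta> (\<nu> e))"
    proof (subst vec_eq_iff, intro allI)
      fix l
      have "y l $ i / s $ i = (\<Sum>e\<in>E. e $ i / e $ \<nu> e * y l $ \<nu> e) / s $ i"
        using interp[of "y l" i] yW y0 by auto
      also have "\<dots> = (\<Sum>e\<in>E. w e * (y l $ \<nu> e / s $ \<nu> e))"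
        using spos by (auto simp: w_def sum_divide_distrib less_imp_neq[THEN not_sym] intro!: sum.cong)
      finally show "?\<beta> i $ l = (\<Sum>e\<in>E. w e *\<^sub>R ?\<beta> (\<nu> e)) $ l"
        by (simp add: basic_function_def s_def)
    qed
    ultimately show ?thesis
      by (simp only:) (intro convex_sum convex_convex_hull E(1) hull_inc imageI)
  qed
  then have "basic_polytope y = convex hull ((\<lambda>e. ?\<beta> (\<nu> e)) ` E)"
    unfolding basic_polytope_def
    by (intro antisym hull_minimal hull_mono convex_convex_hull) auto
  then have "vertices (basic_polytope y) \<subseteq> (\<lambda>e. ?\<beta> (\<nu> e)) ` E"
    unfolding vertices_def by (simp add: extreme_points_of_convex_hull)
  then have "card (vertices (basic_polytope y)) \<le> card E"
    using E(1) by (rule surj_card_le[rotated])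
  also have "\<dots> \<le> dim W"
    using E by (intro independent_card_le_dim)
  finally show ?thesis .
qed

section \<open>Spans of families with nodes\<close>

lemma nodes_coefficient:
  fixes b :: "'d::finite \<Rightarrow> real ^ 'm"
  assumes "nodes b \<iota>"
  shows "(\<Sum>k\<in>UNIV. c k *\<^sub>R b k) $ \<iota> j = c j * b j $ \<iota> j"
proof -
  have "(\<Sum>k\<in>UNIV. c k *\<^sub>R b k) $ \<iota> j = (\<Sum>k\<in>UNIV. c k * b k $ \<iota> j)"
    by simp
  also have "\<dots> = (\<Sum>k\<in>UNIV. if k = j then c j * b j $ \<iota> j else 0)"
    using assms by (intro sum.cong) (auto simp: nodes_def)
  finally have "(\<Sum>k\<in>UNIV. c k *\<^sub>R b k) $ \<iota> j = \<dots>" .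
  then show ?thesis by simp
qed

lemma nodes_inj:
  fixes b :: "'d::finite \<Rightarrow> real ^ 'm"
  assumes "nodes b \<iota>"
  shows "inj b"
  using assms unfolding inj_def nodes_def by (metis less_irrefl)

lemma span_range:
  fixes b :: "'d::finite \<Rightarrow> 'a::real_vector"
  assumes "inj b"
  shows "span (range b) = range (\<lambda>c. \<Sum>k\<in>UNIV. c k *\<^sub>R b k)"
proof (intro antisym subsetI)
  fix x assume "x \<in> span (range b)"
  then obtain u where "x = (\<Sum>v\<in>range b. u v *\<^sub>R v)"
    by (auto simp: span_finite)
  then have "x = (\<Sum>k\<in>UNIV. (u \<circ> b) k *\<^sub>R b k)"
    using assms by (simp add: sum.reindex)
  then show "x \<in> range (\<lambda>c. \<Sum>k\<in>UNIV. c k *\<^sub>R b k)" by blast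
qed (auto intro!: span_sum span_scale intro: span_base)

lemma nodes_expansion:
  fixes b :: "'d::finite \<Rightarrow> real ^ 'm"
  assumes n: "nodes b \<iota>" and x: "x \<in> span (range b)"
  shows "x = (\<Sum>k\<in>UNIV. (x $ \<iota> k / b k $ \<iota> k) *\<^sub>R b k)"
proof -
  obtain c where c: "x = (\<Sum>k\<in>UNIV. c k *\<^sub>R b k)"
    using x by (auto simp: span_range[OF nodes_inj[OF n]])
  have "x $ \<iota> k / b k $ \<iota> k = c k" for k
    unfolding c nodes_coefficient[OF n] using n by (simp add: nodes_def less_imp_neq[THEN not_sym])
  then show ?thesis
    using c by simp
qed

lemma nodes_independent:
  fixes b :: "'d::finite \<Rightarrow> real ^ 'm"
  assumes n: "nodes b \<iota>"
  shows "independent (range b)"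
proof (rule independent_if_scalars_zero)
  fix f x assume 0: "(\<Sum>x\<in>range b. f x *\<^sub>R x) = 0" and x: "x \<in> range b"
  then obtain k where k: "x = b k" by auto
  have "(\<Sum>k\<in>UNIV. f (b k) *\<^sub>R b k) = 0"
    using 0 nodes_inj[OF n] by (simp add: sum.reindex)
  then have "f (b k) * b k $ \<iota> k = 0"
    using nodes_coefficient[OF n, of "\<lambda>k. f (b k)" k] by simp
  then show "f x = 0"
    using n k by (auto simp: nodes_def less_imp_neq[THEN not_sym])
qed simp

text \<open>Expansion coefficients are nodal values divided by positive numbers, and the
  \<open>b k\<close> are nonnegative. Evaluation at the nodes is thus an order embedding of the
  span.\<close>

lemma nodes_le_iff:
  fixes b :: "'d::finite \<Rightarrow> real ^ 'm"
  assumes n: "nodes b \<iota>" and b: "\<And>k. 0 \<le> b k"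
    and x: "x \<in> span (range b)" and z: "z \<in> span (range b)"
  shows "x \<le> z \<longleftrightarrow> (\<forall>k. x $ \<iota> k \<le> z $ \<iota> k)"
proof
  assume le: "\<forall>k. x $ \<iota> k \<le> z $ \<iota> k"
  have "(\<Sum>k\<in>UNIV. (x $ \<iota> k / b k $ \<iota> k) *\<^sub>R b k) \<le> (\<Sum>k\<in>UNIV. (z $ \<iota> k / b k $ \<iota> k) *\<^sub>R b k)"
    using n b le by (intro sum_mono scaleR_right_mono divide_right_mono) (auto simp: nodes_def less_imp_le)
  then show "x \<le> z"
    using nodes_expansion[OF n x] nodes_expansion[OF n z] by simp
qed (simp add: less_eq_vec_def)

lemma positive_basis_of_nodes:
  fixes b :: "'d::finite \<Rightarrow> real ^ 'm"
  assumes n: "nodes b \<iota>" and b: "\<And>k. 0 \<le> b k"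
  shows "positive_basis (span (range b)) b"
proof -
  have "{x \<in> span (range b). 0 \<le> x} = {\<Sum>k\<in>UNIV. c k *\<^sub>R b k | c. \<forall>k. 0 \<le> c k}"
  proof (intro antisym subsetI)
    fix x assume x: "x \<in> {x \<in> span (range b). 0 \<le> x}"
    then have "\<forall>k. 0 \<le> x $ \<iota> k / b k $ \<iota> k"
      using n by (auto simp: nodes_def less_eq_vec_def intro!: divide_nonneg_pos)
    moreover have "x = (\<Sum>k\<in>UNIV. (x $ \<iota> k / b k $ \<iota> k) *\<^sub>R b k)"
      using x nodes_expansion[OF n] by blast
    ultimately show "x \<in> {\<Sum>k\<in>UNIV. c k *\<^sub>R b k | c. \<forall>k. 0 \<le> c k}"
      by (intro CollectI exI[of _ "\<lambda>k. x $ \<iota> k / b k $ \<iota> k"] conjI)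
  next
    fix x assume "x \<in> {\<Sum>k\<in>UNIV. c k *\<^sub>R b k | c. \<forall>k. 0 \<le> c k}"
    then show "x \<in> {x \<in> span (range b). 0 \<le> x}"
      using b by (auto intro!: sum_nonneg scaleR_nonneg_nonneg span_sum span_scale intro: span_base)
  qed
  then show ?thesis
    using nodes_inj[OF n] nodes_independent[OF n] by (simp add: positive_basis_def)
qed

lemma lattice_subspace_of_nodes:
  fixes b :: "'d::finite \<Rightarrow> real ^ 'm"
  assumes n: "nodes b \<iota>" and b: "\<And>k. 0 \<le> b k"
  shows "lattice_subspace (span (range b))"
  unfolding lattice_subspace_def
proof (intro conjI ballI)
  let ?Z = "span (range b)"
  \<comment> \<open>\<open>g\<close> inverts evaluation at the nodes: it yields the vector of the
    span with prescribed nodal values. Suprema and infima are then taken node by node.\<close>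
  define g where "g c = (\<Sum>k\<in>UNIV. (c k / b k $ \<iota> k) *\<^sub>R b k)" for c
  have gZ: "g c \<in> ?Z" for c
    unfolding g_def by (intro span_sum span_scale span_base) auto
  have g: "g c $ \<iota> k = c k" for c k
    unfolding g_def nodes_coefficient[OF n] using n by (simp add: nodes_def less_imp_neq[THEN not_sym])
  note le = nodes_le_iff[OF n b]
  fix x z assume x: "x \<in> ?Z" and z: "z \<in> ?Z"
  have "isLub ?Z {x, z} (g (\<lambda>k. max (x $ \<iota> k) (z $ \<iota> k)))"
    using x z gZ by (auto simp: isLub_def leastP_def isUb_def setle_def setge_def le g)
  then show "\<exists>s. isLub ?Z {x, z} s" by blast
  have "isGlb ?Z {x, z} (g (\<lambda>k. min (x $ \<iota> k) (z $ \<iota> k)))"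
    using x z gZ by (auto simp: isGlb_def greatestP_def isLb_def setle_def setge_def le g)
  then show "\<exists>t. isGlb ?Z {x, z} t" by blast
qed simp

section \<open>Construction of a minimal lattice-subspace from the vertices\<close>

lemma minimal_lattice_subspace_exists:
  fixes y :: "'r::finite \<Rightarrow> real ^ 'm"
  assumes y0: "\<And>l. 0 \<le> y l" and pos: "\<And>i. 0 < (\<Sum>l\<in>UNIV. y l) $ i"
    and d: "CARD('d::finite) = card (vertices (basic_polytope y))"
  obtains b :: "'d::finite \<Rightarrow> real ^ 'm" and \<iota> where
    "nodes b \<iota>" "\<And>k. 0 \<le> b k" "minimal_lattice_subspace (range y) (span (range b))"
proof -
  let ?\<beta> = "basic_function y" and ?K = "basic_polytope y"
  define s where "s = (\<Sum>l\<in>UNIV. y l)"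
  have spos: "0 < s $ i" for i
    using pos by (simp add: s_def)
  have vsub: "vertices ?K \<subseteq> range ?\<beta>"
    unfolding vertices_def basic_polytope_def by (rule extreme_points_of_convex_hull)
  then have vfin: "finite (vertices ?K)"
    by (rule finite_subset) simp
  have K: "?K = convex hull (vertices ?K)"
    unfolding vertices_def basic_polytope_def by (rule Krein_Milman_polytope) simp
  obtain P :: "'d \<Rightarrow> real ^ 'r" where P: "bij_betw P UNIV (vertices ?K)"
    using finite_same_card_bij[of "UNIV :: 'd set" "vertices ?K"] vfin d by auto
  have "P k \<in> range ?\<beta>" for k
    using P vsub by (auto simp: bij_betw_def)
  then obtain \<iota> where \<iota>: "\<And>k. P k = ?\<beta> (\<iota> k)"
    unfolding image_iff by metis
  have Pinj: "P j = P k \<longleftrightarrow> j = k" for j k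
    using P by (auto simp: bij_betw_def inj_def)
  \<comment> \<open>The last conjunct prescribes unit coefficients when \<open>x\<close> is itself a
    vertex; this is what makes the \<open>\<iota> k\<close> nodes of \<open>b\<close>.\<close>
  have coeffs: "\<exists>c. (\<forall>k. 0 \<le> c k) \<and> x = (\<Sum>k\<in>UNIV. c k *\<^sub>R P k) \<and>
      (\<forall>k. x = P k \<longrightarrow> c = (\<lambda>j. if j = k then 1 else 0))" if x: "x \<in> ?K" for x
  proof (cases "x \<in> range P")
    case True
    then obtain k where k: "x = P k" by auto
    have "(\<Sum>j\<in>UNIV. (if j = k then 1 else 0 :: real) *\<^sub>R P j) = (\<Sum>j\<in>UNIV. if j = k then P k else 0)"
      by (intro sum.cong) auto
    then show ?thesis
      using k by (intro exI[of _ "\<lambda>j. if j = k then 1 else 0"]) (auto simp: Pinj)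
  next
    case False
    obtain u where u: "\<And>v. v \<in> vertices ?K \<Longrightarrow> 0 \<le> u v" "x = (\<Sum>v\<in>vertices ?K. u v *\<^sub>R v)"
      using x vfin by (subst (asm) K) (auto simp: convex_hull_finite)
    have "x = (\<Sum>k\<in>UNIV. u (P k) *\<^sub>R P k)"
      using u(2) sum.reindex_bij_betw[OF P, of "\<lambda>v. u v *\<^sub>R v"] by simp
    moreover have "0 \<le> u (P k)" for k
      using P u(1) by (auto simp: bij_betw_def)
    ultimately show ?thesis
      using False by (intro exI[of _ "\<lambda>k. u (P k)"]) auto
  qed
  have "\<forall>i. ?\<beta> i \<in> ?K"
    unfolding basic_polytope_def by (auto intro: hull_inc)
  then have "\<forall>i. \<exists>c. (\<forall>k. 0 \<le> c k) \<and> ?\<beta> i = (\<Sum>k\<in>UNIV. c k *\<^sub>R P k) \<and>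
      (\<forall>k. ?\<beta> i = P k \<longrightarrow> c = (\<lambda>j. if j = k then 1 else 0))"
    using coeffs by blast
  from choice[OF this] obtain \<xi> where \<xi>: "\<And>i k. 0 \<le> \<xi> i k" "\<And>i. ?\<beta> i = (\<Sum>k\<in>UNIV. \<xi> i k *\<^sub>R P k)"
    "\<And>i k. ?\<beta> i = P k \<Longrightarrow> \<xi> i = (\<lambda>j. if j = k then 1 else 0)"
    by blast
  \<comment> \<open>The factor \<open>s $ i\<close> undoes the division in \<beta>, so that
    \<open>y l\<close> is the combination of the \<open>b k\<close> with coefficients
    \<open>P k $ l\<close>.\<close>
  define b where "b k = (\<chi> i. s $ i * \<xi> i k)" for k
  have n: "nodes b \<iota>"
    using \<xi>(3)[OF \<iota>[symmetric]] spos by (auto simp: nodes_def b_def)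
  have b0: "0 \<le> b k" for k
    using \<xi>(1) spos by (auto simp: b_def less_eq_vec_def intro!: mult_nonneg_nonneg intro: less_imp_le)
  let ?Z = "span (range b)"
  have "y l \<in> ?Z" for l
  proof -
    have "y l $ i = (\<Sum>k\<in>UNIV. P k $ l *\<^sub>R b k) $ i" for i
    proof -
      have "y l $ i = s $ i * ?\<beta> i $ l"
        using spos[of i] by (simp add: basic_function_def s_def less_imp_neq[THEN not_sym])
      also have "\<dots> = s $ i * (\<Sum>k\<in>UNIV. \<xi> i k * P k $ l)"
        by (subst \<xi>(2)) simp
      finally show ?thesis
        by (simp add: b_def sum_distrib_left mult_ac)
    qed
    then have "y l = (\<Sum>k\<in>UNIV. P k $ l *\<^sub>R b k)"
      by (simp add: vec_eq_iff)
    then show ?thesis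
      by (auto intro!: span_sum span_scale intro: span_base)
  qed
  \<comment> \<open>A proper lattice-subspace containing the \<open>y l\<close> would have dimension
    below the number of vertices, against the dimension bound.\<close>
  moreover have "\<not> (W \<subset> ?Z \<and> lattice_subspace W \<and> range y \<subseteq> W)" for W
  proof
    assume W: "W \<subset> ?Z \<and> lattice_subspace W \<and> range y \<subseteq> W"
    then have "span W = W"
      by (simp add: lattice_subspace_def span_eq_iff)
    then have "dim W < dim ?Z"
      using W by (intro dim_psubset) (simp only: span_span)
    also have "\<dots> = CARD('d)"
      using nodes_independent[OF n] nodes_inj[OF n] by (simp add: dim_eq_card_independent card_image)
    also have "\<dots> \<le> dim W"
      using card_vertices_le_dim[of W y] W y0 pos d by simp
    finally show False by simp
  qed
  ultimately have "minimal_lattice_subspace (range y) ?Z"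
    using lattice_subspace_of_nodes[OF n b0] by (auto simp: minimal_lattice_subspace_def)
  then show thesis
    using that n b0 by blast
qed

section \<open>Basic sets of rows\<close>

lemma basic_set_span_rows:
  assumes "basic_set A y"
  shows "rows A \<subseteq> span (range y)"
proof -
  have y: "range y \<subseteq> rows A" "independent (range y)"
    and max: "\<And>B. range y \<subseteq> B \<Longrightarrow> B \<subseteq> rows A \<Longrightarrow> independent B \<Longrightarrow> B = range y"
    using assms by (auto simp: basic_set_def)
  obtain B where "range y \<subseteq> B" "B \<subseteq> rows A" "independent B" "rows A \<subseteq> span B"
    using maximal_independent_subset_extend[OF y] by blast
  then show ?thesis
    using max by blast
qed

lemma basic_set_card:
  fixes y :: "'r::finite \<Rightarrow> real ^ 'm" and A :: "real ^ 'm ^ 'n"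
  assumes "basic_set A y"
  shows "CARD('r) = rank A"
proof -
  have y: "inj y" "range y \<subseteq> rows A" "independent (range y)"
    using assms by (auto simp: basic_set_def)
  have "span (range y) = span (rows A)"
    using basic_set_span_rows[OF assms] y by (auto simp: span_eq intro: span_base)
  then have "dim (rows A) = card (range y)"
    using y by (intro dim_eq_card) auto
  then show ?thesis
    using y by (simp add: row_rank_def card_image)
qed

lemma basic_set_nonneg:
  assumes "nonneg_matrix A" "basic_set A y"
  shows "0 \<le> y l"
proof -
  have "y l \<in> rows A"
    using assms by (auto simp: basic_set_def)
  then show ?thesis
    using assms by (auto simp: rows_def row_def nonneg_matrix_def less_eq_vec_def)
qed

text \<open>If the sum vanishes at \<open>i\<close>, nonnegativity makes every \<open>y l\<close>
  vanish there. The rows of \<open>A\<close> lie in the span of the \<open>y l\<close>, so column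
  \<open>i\<close> would be zero.\<close>

lemma basic_set_sum_pos:
  fixes y :: "'r::finite \<Rightarrow> real ^ 'm"
  assumes A: "nonneg_matrix A" and col: "\<And>j. column j A \<noteq> 0" and y: "basic_set A y"
  shows "0 < (\<Sum>l\<in>UNIV. y l) $ i"
proof (rule ccontr)
  assume "\<not> 0 < (\<Sum>l\<in>UNIV. y l) $ i"
  moreover have y0: "0 \<le> y l $ i" for l
    using basic_set_nonneg[OF A y] by (simp add: less_eq_vec_def)
  ultimately have "(\<Sum>l\<in>UNIV. y l $ i) = 0"
    using sum_nonneg[of UNIV "\<lambda>l. y l $ i"] by simp
  then have "range y \<subseteq> {x. x $ i = 0}"
    using y0 by (auto simp: sum_nonneg_eq_0_iff)
  moreover have "subspace {x :: real ^ 'm. x $ i = 0}"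
    by (auto simp: subspace_def)
  ultimately have "span (range y) \<subseteq> {x. x $ i = 0}"
    by (rule span_minimal)
  then have "rows A \<subseteq> {x. x $ i = 0}"
    using basic_set_span_rows[OF y] by blast
  then have "column i A = 0"
    by (auto simp: rows_def row_def column_def vec_eq_iff)
  then show False
    using col by simp
qed

section \<open>Upper bounds on the number of vertices\<close>

text \<open>The coordinates of each \<beta>(i) sum to 1, so for two coordinates the polytope lies on
  a line and is a segment, possibly a single point.\<close>

lemma card_vertices_le_2:
  fixes y :: "'r::finite \<Rightarrow> real ^ 'm"
  assumes pos: "\<And>i. 0 < (\<Sum>l\<in>UNIV. y l) $ i" and "CARD('r) = 2"
  shows "card (vertices (basic_polytope y)) \<le> 2"
proof -
  let ?K = "basic_polytope y"
  obtain p q :: 'r where pq: "UNIV = {p, q}" "p \<noteq> q"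
    using assms(2) by (auto simp: card_2_iff)
  have all: "l = p \<or> l = q" for l
    using pq(1) by auto
  have sum2: "(\<Sum>l\<in>UNIV. f l) = f p + f q" for f :: "'r \<Rightarrow> real"
    by (subst pq(1)) (use pq(2) in simp)
  define H where "H = {x :: real ^ 'r. x $ p + x $ q = 1}"
  have "convex H"
    using convex_hyperplane[of "axis p 1 + axis q 1 :: real ^ 'r" 1]
    by (simp add: H_def inner_add_left inner_axis')
  moreover have "basic_function y i \<in> H" for i
    using pos[of i] by (simp add: H_def basic_function_def sum2 add_divide_distrib[symmetric])
  ultimately have KH: "?K \<subseteq> H"
    unfolding basic_polytope_def by (intro hull_minimal) auto
  have "collinear ?K"
    unfolding collinear_def
  proof (intro exI[of _ "axis p 1 - axis q 1"] ballI)
    fix x z assume "x \<in> ?K" "z \<in> ?K"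
    then have "x \<in> H" "z \<in> H" using KH by auto
    then have "(x - z) $ l = ((x $ p - z $ p) *\<^sub>R (axis p 1 - axis q 1)) $ l" for l
      using all[of l] pq(2) by (auto simp: H_def axis_def)
    then have "x - z = (x $ p - z $ p) *\<^sub>R (axis p 1 - axis q 1)"
      by (intro vec_eq_iff[THEN iffD2] allI)
    then show "\<exists>c. x - z = c *\<^sub>R (axis p 1 - axis q 1)" by blast
  qed
  moreover have "compact ?K" "convex ?K" "?K \<noteq> {}"
    unfolding basic_polytope_def by (auto simp: finite_imp_compact_convex_hull)
  ultimately obtain a c where "?K = closed_segment a c"
    using compact_convex_collinear_segment by blast
  then have "vertices ?K = {a, c}"
    by (auto simp: vertices_def extreme_point_of_segment)
  then show ?thesis
    by (simp add: card_insert_if)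
qed

lemma card_vertices_le_card_range:
  fixes y :: "'r::finite \<Rightarrow> real ^ 'm"
  shows "card (vertices (basic_polytope y)) \<le> card (range (basic_function y))"
  unfolding vertices_def basic_polytope_def
  by (intro card_mono extreme_points_of_convex_hull) simp

section \<open>The factorization\<close>

lemma positive_basis_dim:
  fixes b :: "'d::finite \<Rightarrow> real ^ 'm"
  assumes "positive_basis Z b"
  shows "dim Z = CARD('d)"
  using assms dim_span_eq_card_independent[of "range b"] by (auto simp: positive_basis_def card_image)

lemma positive_basis_nonneg:
  fixes b :: "'d::finite \<Rightarrow> real ^ 'm"
  assumes "positive_basis Z b"
  shows "0 \<le> b k"
proof -
  have "b k = (\<Sum>j\<in>UNIV. (if j = k then 1 else 0 :: real) *\<^sub>R b j)"
    by (simp add: if_distrib[of "\<lambda>c. c *\<^sub>R _"] cong: if_cong)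
  then have "b k \<in> {\<Sum>k\<in>UNIV. c k *\<^sub>R b k | c. \<forall>k. 0 \<le> c k}"
    by (intro CollectI exI[of _ "\<lambda>j. if j = k then 1 else 0"]) auto
  also have "\<dots> = {x \<in> Z. 0 \<le> x}"
    using assms by (simp add: positive_basis_def)
  finally show ?thesis by simp
qed

text \<open>Row \<open>i\<close> of \<open>F\<close> lists the coefficients of row \<open>i\<close>
  of \<open>A\<close> in the basis \<open>b\<close>, as read off at the nodes.\<close>

lemma nodes_factorization:
  fixes A :: "real ^ 'm ^ 'n" and F :: "real ^ 'd ^ 'n" and V :: "real ^ 'm ^ 'd"
    and b :: "'d \<Rightarrow> real ^ 'm"
  assumes n: "nodes b \<iota>" and A: "rows A \<subseteq> span (range b)"
    and F: "\<And>k. column k F = (1 / b k $ \<iota> k) *\<^sub>R column (\<iota> k) A" and V: "\<And>k. row k V = b k"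
  shows "A = F ** V"
proof -
  have Fe: "F $ i $ k = A $ i $ \<iota> k / b k $ \<iota> k" for i k
    using F[of k] by (simp add: column_def vec_eq_iff)
  have Ve: "V $ k = b k" for k
    using V[of k] by (simp add: row_def vec_eq_iff)
  have "(\<Sum>k\<in>UNIV. A $ i $ \<iota> k / b k $ \<iota> k * b k $ j) = A $ i $ j" for i j
  proof -
    have "A $ i \<in> span (range b)"
      using A by (auto simp: rows_def row_def)
    from arg_cong[OF nodes_expansion[OF n this], of "\<lambda>x. x $ j", symmetric] show ?thesis
      by simp
  qed
  then show ?thesis
    by (simp add: vec_eq_iff matrix_matrix_mult_def Fe Ve)
qed

theorem theorem1p2:
  fixes A :: "real ^ 'm ^ 'n"
    and y :: "'r::finite \<Rightarrow> real ^ 'm"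
  assumes nonneg: "nonneg_matrix A"
    and no_zero_column: "\<And>j. column j A \<noteq> 0"
    and basic: "basic_set A y"
    and d: "CARD('d::finite) = card (vertices (basic_polytope y))"
  shows
    "(\<exists>(F :: real ^ 'd ^ 'n) (V :: real ^ 'm ^ 'd).
        nonneg_matrix F \<and> nonneg_matrix V \<and> A = F ** V) \<and>
     (\<exists>Z (b :: 'd \<Rightarrow> real ^ 'm) \<iota>.
        minimal_lattice_subspace (range y) Z \<and> positive_basis Z b \<and> nodes b \<iota>) \<and>
     (\<forall>Z (b :: 'd \<Rightarrow> real ^ 'm) \<iota> (F :: real ^ 'd ^ 'n) (V :: real ^ 'm ^ 'd).
        minimal_lattice_subspace (range y) Z \<and> positive_basis Z b \<and> nodes b \<iota> \<and>
        (\<forall>k. column k F = (1 / b k $ \<iota> k) *\<^sub>R column (\<iota> k) A) \<and>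
        (\<forall>k. row k V = b k) \<longrightarrow>
          nonneg_matrix F \<and> nonneg_matrix V \<and> A = F ** V \<and>
          (CARD('r) = 2 \<longrightarrow> CARD('d) = 2 \<and> rank_factorization A F V) \<and>
          (card (range (basic_function y)) = CARD('r) \<longrightarrow> rank_factorization A F V) \<and>
          (card (vertices (basic_polytope y)) = CARD('r) \<longrightarrow>
             CARD('r) = CARD('d) \<and> rank_factorization A F V) \<and>
          (CARD('d) = CARD('m) \<longrightarrow>
             positive_basis (UNIV :: (real ^ 'm) set) (\<lambda>k. row k V)))"
proof -
  note y0 = basic_set_nonneg[OF nonneg basic]
    and pos = basic_set_sum_pos[OF nonneg no_zero_column basic]
    and rank = basic_set_card[OF basic]
  have fact: "nonneg_matrix F \<and> nonneg_matrix V \<and> A = F ** V \<and> CARD('r) \<le> CARD('d) \<and>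
      (CARD('d) = CARD('m) \<longrightarrow> positive_basis (UNIV :: (real ^ 'm) set) (\<lambda>k. row k V))"
    if Z: "minimal_lattice_subspace (range y) Z" and b: "positive_basis Z b" and n: "nodes b \<iota>"
      and F: "\<forall>k. column k F = (1 / b k $ \<iota> k) *\<^sub>R column (\<iota> k) A" and V: "\<forall>k. row k V = b k"
    for Z and b :: "'d \<Rightarrow> real ^ 'm" and \<iota> and F :: "real ^ 'd ^ 'n" and V :: "real ^ 'm ^ 'd"
  proof (intro conjI impI)
    have sp: "span (range b) = Z" and yZ: "range y \<subseteq> Z" and Zs: "subspace Z"
      using b Z by (auto simp: positive_basis_def minimal_lattice_subspace_def lattice_subspace_def)
    show "nonneg_matrix F"
      unfolding nonneg_matrix_def
    proof (intro allI)
      fix i k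
      have "F $ i $ k = A $ i $ \<iota> k / b k $ \<iota> k"
        using F[rule_format, of k] by (simp add: column_def vec_eq_iff)
      then show "0 \<le> F $ i $ k"
        using n nonneg by (auto simp: nodes_def nonneg_matrix_def less_imp_le)
    qed
    show "nonneg_matrix V"
      unfolding nonneg_matrix_def
    proof (intro allI)
      fix k j
      have "V $ k $ j = b k $ j"
        using V[rule_format, of k] by (simp add: row_def vec_eq_iff)
      then show "0 \<le> V $ k $ j"
        using positive_basis_nonneg[OF b] by (simp add: less_eq_vec_def)
    qed
    have "rows A \<subseteq> span (range b)"
      using basic_set_span_rows[OF basic] span_minimal[OF yZ Zs] sp by blast
    then show "A = F ** V"
      using n F V by (intro nodes_factorization) auto
    \<comment> \<open>The independent \<open>y l\<close> lie in \<open>Z\<close>, so r \<le> d.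
      Cases (i) and (ii) combine this with an upper bound on d.\<close>
    have "CARD('r) = card (range y)"
      using basic by (simp add: basic_set_def card_image)
    also have "\<dots> \<le> dim Z"
      using basic yZ by (intro independent_card_le_dim) (auto simp: basic_set_def)
    also have "\<dots> = CARD('d)"
      by (rule positive_basis_dim[OF b])
    finally show "CARD('r) \<le> CARD('d)" .
    assume "CARD('d) = CARD('m)"
    then have "Z = UNIV"
      using positive_basis_dim[OF b] Zs dim_eq_full[of Z] by (simp add: span_eq_iff[THEN iffD2])
    then show "positive_basis (UNIV :: (real ^ 'm) set) (\<lambda>k. row k V)"
      using b V by simp
  qed
  have rf: "rank_factorization A F V"
    if "nonneg_matrix F" "nonneg_matrix V" "A = F ** V" "CARD('d) = CARD('r)"
    for F :: "real ^ 'd ^ 'n" and V :: "real ^ 'm ^ 'd"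
    using that rank by (simp add: rank_factorization_def)
  \<comment> \<open>Only existence uses this particular basis; the claims about the factorization
    hold for arbitrary \<open>Z\<close>, \<open>b\<close> and \<open>\<iota>\<close> by
    \<open>fact\<close>.\<close>
  obtain b :: "'d \<Rightarrow> real ^ 'm" and \<iota> where n: "nodes b \<iota>" and b0: "\<And>k. 0 \<le> b k"
    and Z: "minimal_lattice_subspace (range y) (span (range b))"
    using minimal_lattice_subspace_exists[OF y0 pos d] by blast
  note pb = positive_basis_of_nodes[OF n b0]
  define F :: "real ^ 'd ^ 'n" where "F = (\<chi> i k. A $ i $ \<iota> k / b k $ \<iota> k)"
  define V :: "real ^ 'm ^ 'd" where "V = (\<chi> k. b k)"
  have "\<forall>k. column k F = (1 / b k $ \<iota> k) *\<^sub>R column (\<iota> k) A" "\<forall>k. row k V = b k"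
    by (auto simp: F_def V_def column_def row_def vec_eq_iff)
  then have ex: "nonneg_matrix F \<and> nonneg_matrix V \<and> A = F ** V"
    using fact[OF Z pb n] by blast
  have upper: "CARD('r) = 2 \<Longrightarrow> CARD('d) \<le> 2"
    "card (range (basic_function y)) = CARD('r) \<Longrightarrow> CARD('d) \<le> CARD('r)"
    using card_vertices_le_2[OF pos] card_vertices_le_card_range[of y] d by simp_all
  show ?thesis
  proof (intro conjI allI impI)
    show "\<exists>(F :: real ^ 'd ^ 'n) (V :: real ^ 'm ^ 'd).
        nonneg_matrix F \<and> nonneg_matrix V \<and> A = F ** V"
      using ex by blast
    show "\<exists>Z (b :: 'd \<Rightarrow> real ^ 'm) \<iota>.
        minimal_lattice_subspace (range y) Z \<and> positive_basis Z b \<and> nodes b \<iota>"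
      using Z pb n by blast
  next
    fix Z and b :: "'d \<Rightarrow> real ^ 'm" and \<iota> and F :: "real ^ 'd ^ 'n" and V :: "real ^ 'm ^ 'd"
    assume "minimal_lattice_subspace (range y) Z \<and> positive_basis Z b \<and> nodes b \<iota> \<and>
        (\<forall>k. column k F = (1 / b k $ \<iota> k) *\<^sub>R column (\<iota> k) A) \<and> (\<forall>k. row k V = b k)"
    then have *: "nonneg_matrix F" "nonneg_matrix V" "A = F ** V" "CARD('r) \<le> CARD('d)"
      and triv: "CARD('d) = CARD('m) \<longrightarrow> positive_basis (UNIV :: (real ^ 'm) set) (\<lambda>k. row k V)"
      using fact[of Z b \<iota> F V] by auto
    show "nonneg_matrix F" "nonneg_matrix V" "A = F ** V"
      by (rule *)+
    show "CARD('d) = 2" if "CARD('r) = 2"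
      using upper(1) *(4) that by simp
    then show "rank_factorization A F V" if "CARD('r) = 2"
      using rf[OF *(1-3)] that by simp
    show "rank_factorization A F V" if "card (range (basic_function y)) = CARD('r)"
      using rf[OF *(1-3)] upper(2) *(4) that by simp
    show "CARD('r) = CARD('d)" if "card (vertices (basic_polytope y)) = CARD('r)"
      using d that by simp
    then show "rank_factorization A F V" if "card (vertices (basic_polytope y)) = CARD('r)"
      using rf[OF *(1-3)] that by simp
    show "positive_basis (UNIV :: (real ^ 'm) set) (\<lambda>k. row k V)" if "CARD('d) = CARD('m)"
      using triv that by simp
  qed
qed

end
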